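(* Let $\mathcal{F}$ be a family of graphs with generating function $F(z,w)$. For all nonnegative integers $n,m$, the number of $(n,m)$-graphs in which one $\mathcal{F}$-subgraph is distinguished (i.e. the number of pairs $(G,S)$ where $G$ is an $(n,m)$-graph and $S$ is a subgraph of $G$ that is an $\mathcal{F}$-graph) is equal to $$ n!\,[z^n w^m]\; F\!\left(z,\frac{w}{1+w}\right) e^{z} (1+w)^{\binom{n}{2}} .$$ Moreover, suppose that $F(z,w)$ is an entire function, that $m=m(n)$ tends to infinity with $n$ while $m=o(n^2)$, and that the functions $$(z,w)\mapsto \frac{F\!\left(nz,\; m w/\binom{n}{2}\right)}{F\!\left(n,\; m/\binom{n}{2}\right)}$$ converge, as $n\to\infty$, uniformly on any compact set to an analytic function. Then, as $n\to\infty$, this number is asymptotically equivalent to $$\binom{\binom{n}{2}}{m}\, F\!\left(n, \frac{m}{\binom{n}{2}}\right).$$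
   Context: A graph $G=(V(G),E(G))$ has a finite set of labeled vertices and a set of edges, each an unordered pair of distinct vertices (no loops, no multiple edges). An $(n,m)$-graph is a graph with $n$ vertices, labeled from $1$ to $n$, and $m$ edges. $S$ is a subgraph of $G$ if $V(S)\subset V(G)$ and $E(S)\subset E(G)$ (not necessarily induced). Two graphs are isomorphic if there is a bijection between their vertex sets inducing a bijection between their edge sets. For a graph family $\mathcal{F}$, an $\mathcal{F}$-graph is a graph isomorphic to some member of $\mathcal{F}$, and an $\mathcal{F}$-subgraph of $G$ is a subgraph of $G$ that is an $\mathcal{F}$-graph. The generating function of $\mathcal{F}$ is $$F(z,w)=\sum_{n,m\ge 0}\mathcal{F}_{n,m}\,w^m\frac{z^n}{n!},$$ where $\mathcal{F}_{n,m}$ is the number of $(n,m)$-graphs isomorphic to a graph from $\mathcal{F}$. $[z^n w^m]$ denotes extraction of the coefficient of $z^n w^m$ in a formal power series. *)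

theory Defs
  imports
    "HOL-Analysis.Analysis"
    "HOL-Computational_Algebra.Formal_Power_Series"
    "HOL-Library.Landau_Symbols"
begin

type_synonym 'a graph = "'a set \<times> 'a set set"

abbreviation verts :: "'a graph \<Rightarrow> 'a set" where
  "verts G \<equiv> fst G"

abbreviation edges :: "'a graph \<Rightarrow> 'a set set" where
  "edges G \<equiv> snd G"

definition is_graph :: "'a graph \<Rightarrow> bool" where
  "is_graph G \<longleftrightarrow>
     finite (verts G) \<and> (\<forall>e\<in>edges G. e \<subseteq> verts G \<and> card e = 2)"

definition nm_graph :: "nat \<Rightarrow> nat \<Rightarrow> nat graph \<Rightarrow> bool" where
  "nm_graph n m G \<longleftrightarrow> is_graph G \<and> verts G = {1..n} \<and> card (edges G) = m"

definition subgraph :: "'a graph \<Rightarrow> 'a graph \<Rightarrow> bool" where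
  "subgraph S G \<longleftrightarrow> is_graph S \<and> verts S \<subseteq> verts G \<and> edges S \<subseteq> edges G"

definition graph_iso :: "'a graph \<Rightarrow> 'b graph \<Rightarrow> bool" where
  "graph_iso G H \<longleftrightarrow>
     (\<exists>f. bij_betw f (verts G) (verts H) \<and> bij_betw (\<lambda>e. f ` e) (edges G) (edges H))"

definition family_graph :: "'a graph set \<Rightarrow> 'b graph \<Rightarrow> bool" where
  "family_graph \<F> G \<longleftrightarrow> is_graph G \<and> (\<exists>H\<in>\<F>. graph_iso G H)"

definition family_count :: "'a graph set \<Rightarrow> nat \<Rightarrow> nat \<Rightarrow> nat" where
  "family_count \<F> n m = card {G. nm_graph n m G \<and> family_graph \<F> G}"

definition distinguished_count :: "'a graph set \<Rightarrow> nat \<Rightarrow> nat \<Rightarrow> nat" where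
  "distinguished_count \<F> n m =
     card {(G, S). nm_graph n m G \<and> subgraph S G \<and> family_graph \<F> S}"

text \<open>
  A series in \<open>z\<close> and \<open>w\<close> is a series in \<open>z\<close> whose coefficients are series in \<open>w\<close>.
\<close>

type_synonym fps2 = "complex fps fps"

definition coeff2 :: "nat \<Rightarrow> nat \<Rightarrow> fps2 \<Rightarrow> complex" where
  "coeff2 i j F = fps_nth (fps_nth F i) j"

definition in_z :: "complex fps \<Rightarrow> fps2" where
  "in_z f = Abs_fps (\<lambda>i. fps_const (fps_nth f i))"

definition in_w :: "complex fps \<Rightarrow> fps2" where
  "in_w f = fps_const f"

text \<open>The series \<open>F(z, g(w))\<close>; meaningful when \<open>g\<close> has zero constant term.\<close>

definition subst_w :: "fps2 \<Rightarrow> complex fps \<Rightarrow> fps2" where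
  "subst_w F g = Abs_fps (\<lambda>i. fps_compose (fps_nth F i) g)"

definition eval2 :: "fps2 \<Rightarrow> complex \<Rightarrow> complex \<Rightarrow> complex" where
  "eval2 F z w = (\<Sum>\<^sub>\<infinity>(i, j)\<in>UNIV. coeff2 i j F * z ^ i * w ^ j)"

text \<open>Summability over \<open>UNIV\<close> is unconditional, hence absolute, convergence.\<close>

definition entire2 :: "fps2 \<Rightarrow> bool" where
  "entire2 F \<longleftrightarrow> (\<forall>z w. (\<lambda>(i, j). coeff2 i j F * z ^ i * w ^ j) summable_on UNIV)"

text \<open>Analyticity on the whole of \<open>\<complex> \<times> \<complex>\<close>: a convergent Taylor expansion around every point.\<close>

definition analytic2 :: "(complex \<times> complex \<Rightarrow> complex) \<Rightarrow> bool" where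
  "analytic2 f \<longleftrightarrow>
     (\<forall>a b. \<exists>A::fps2. \<exists>r>0. \<forall>z w. norm z < r \<and> norm w < r \<longrightarrow>
        ((\<lambda>(i, j). coeff2 i j A * z ^ i * w ^ j) has_sum f (a + z, b + w)) UNIV)"

definition gen_fun :: "'a graph set \<Rightarrow> fps2" where
  "gen_fun \<F> = Abs_fps (\<lambda>n. Abs_fps (\<lambda>m. of_nat (family_count \<F> n m) / fact n))"

end

theory Submission
  imports Defs
begin

text \<open>
  Write \<open>N\<close> for \<open>n choose 2\<close> and \<open>a k j\<close> for the number of labelled \<open>\<F>\<close>-graphs with \<open>k\<close> vertices and
  \<open>j\<close> edges. Choosing the vertex set of \<open>S\<close>, then \<open>S\<close>, then the remaining \<open>m - j\<close> edges of \<open>G\<close> gives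
  the count \<open>\<Sum>k j. (n choose k) * a k j * ((N - j) choose (m - j))\<close>, and the last factor is the
  coefficient of \<open>w ^ m\<close> in \<open>(w / (1 + w)) ^ j * (1 + w) ^ N\<close>.

  Divided by \<open>N choose m\<close>, the \<open>(k, j)\<close> summand is the corresponding term of \<open>F(n, m / N)\<close> times a
  weight in \<open>[0, 1]\<close> that is at least \<open>1 - k\<^sup>2 / n - j\<^sup>2 / m\<close>. As \<open>k\<^sup>2\<close> and \<open>j\<^sup>2\<close> are at most
  \<open>2 * 2 ^ k * 2 ^ j\<close>, the total defect is at most \<open>2 * (1 / n + 1 / m) * F(2 * n, 2 * m / N)\<close>, and
  convergence of the quotients at the single point \<open>(2, 2)\<close> bounds \<open>F(2 * n, 2 * m / N)\<close> by a
  constant times \<open>F(n, m / N)\<close>.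
\<close>

section \<open>Counting distinguished subgraphs\<close>

definition two_sets :: "'a set \<Rightarrow> 'a set set" where
  "two_sets V = {e. e \<subseteq> V \<and> card e = 2}"

lemma finite_two_sets [simp]: "finite V \<Longrightarrow> finite (two_sets V)"
  by (auto simp: two_sets_def intro: finite_subset[of _ "Pow V"])

lemma card_two_sets: "finite V \<Longrightarrow> card (two_sets V) = card V choose 2"
  by (simp add: two_sets_def n_subsets)

lemma is_graph_iff: "is_graph G \<longleftrightarrow> finite (verts G) \<and> edges G \<subseteq> two_sets (verts G)"
  by (auto simp: is_graph_def two_sets_def)

text \<open>Removing \<open>B\<close> turns such a \<open>C\<close> into a subset of
  \<open>A - B\<close> of size \<open>m - card B\<close>, and adding \<open>B\<close> back inverts
  this. The case \<open>card B > m\<close> is split off because truncated subtraction would give 1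
  instead of 0.\<close>

lemma card_supersets:
  assumes "finite A" "B \<subseteq> A"
  shows "card {C. B \<subseteq> C \<and> C \<subseteq> A \<and> card C = m} =
    (if card B \<le> m then (card A - card B) choose (m - card B) else 0)"
proof (cases "card B \<le> m")
  case True
  have fB: "finite B" using assms finite_subset by blast
  have "bij_betw (\<lambda>D. D \<union> B) {D. D \<subseteq> A - B \<and> card D = m - card B}
          {C. B \<subseteq> C \<and> C \<subseteq> A \<and> card C = m}"
  proof (rule bij_betw_byWitness[where f' = "\<lambda>C. C - B"])
    show "(\<lambda>D. D \<union> B) ` {D. D \<subseteq> A - B \<and> card D = m - card B}
        \<subseteq> {C. B \<subseteq> C \<and> C \<subseteq> A \<and> card C = m}"
    proof clarify
      fix D assume D: "D \<subseteq> A - B" "card D = m - card B"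
      have "card (D \<union> B) = card D + card B"
        using D fB assms by (intro card_Un_disjoint) (auto intro: finite_subset)
      then show "B \<subseteq> D \<union> B \<and> D \<union> B \<subseteq> A \<and> card (D \<union> B) = m"
        using D assms True by auto
    qed
    show "(\<lambda>C. C - B) ` {C. B \<subseteq> C \<and> C \<subseteq> A \<and> card C = m}
        \<subseteq> {D. D \<subseteq> A - B \<and> card D = m - card B}"
      using fB by (auto simp: card_Diff_subset)
  qed auto
  then have "card {C. B \<subseteq> C \<and> C \<subseteq> A \<and> card C = m}
      = card {D. D \<subseteq> A - B \<and> card D = m - card B}"
    by (rule bij_betw_same_card[symmetric])
  also have "\<dots> = (card A - card B) choose (m - card B)"
    using assms fB by (simp add: n_subsets card_Diff_subset)
  finally show ?thesis using True by simp
next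
  case False
  then have "{C. B \<subseteq> C \<and> C \<subseteq> A \<and> card C = m} = {}"
    using assms by (auto dest: card_mono[rotated] finite_subset)
  then show ?thesis using False by (simp only: card.empty if_False)
qed

section \<open>Relabelling of graphs and invariance of the counts\<close>

lemma graph_iso_trans:
  assumes "graph_iso G H" "graph_iso H K"
  shows "graph_iso G K"
proof -
  obtain f g where fg: "bij_betw f (verts G) (verts H)" "bij_betw ((`) f) (edges G) (edges H)"
      "bij_betw g (verts H) (verts K)" "bij_betw ((`) g) (edges H) (edges K)"
    using assms unfolding graph_iso_def by blast
  have "(`) g \<circ> (`) f = (`) (g \<circ> f)" by (auto simp: image_comp)
  then show ?thesis
    using bij_betw_trans[OF fg(1,3)] bij_betw_trans[OF fg(2,4)] unfolding graph_iso_def by metis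
qed

definition map_graph :: "('a \<Rightarrow> 'b) \<Rightarrow> 'a graph \<Rightarrow> 'b graph" where
  "map_graph f G = (f ` verts G, (`) f ` edges G)"

lemma inj_on_image_edges:
  assumes "is_graph G" "inj_on f (verts G)"
  shows "inj_on ((`) f) (edges G)"
  using assms by (intro inj_on_subset[OF inj_on_image_Pow[OF assms(2)]]) (auto simp: is_graph_def)

lemma is_graph_map_graph:
  assumes "is_graph G" "inj_on f (verts G)"
  shows "is_graph (map_graph f G)"
proof -
  have "card (f ` e) = 2" if "e \<in> edges G" for e
    using assms that by (subst card_image) (auto simp: is_graph_def intro: inj_on_subset)
  then show ?thesis using assms(1) by (force simp: is_graph_def map_graph_def)
qed

lemma graph_iso_map_graph:
  assumes "is_graph G" "inj_on f (verts G)"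
  shows "graph_iso (map_graph f G) G"
proof -
  let ?g = "inv_into (verts G) f"
  have inv: "?g ` f ` e = e" if "e \<in> edges G" for e
    using assms that by (auto simp: is_graph_def intro!: inv_into_image_cancel)
  have "bij_betw ((`) ?g) ((`) f ` edges G) (edges G)"
    by (rule bij_betw_byWitness[where f' = "(`) f"]) (auto simp: inv)
  moreover have "bij_betw ?g (f ` verts G) (verts G)"
    using assms by (simp add: bij_betw_inv_into bij_betw_imageI)
  ultimately show "graph_iso (map_graph f G) G"
    by (auto simp: graph_iso_def map_graph_def)
qed

lemma family_graph_map_graph:
  assumes "family_graph \<F> G" "inj_on f (verts G)"
  shows "family_graph \<F> (map_graph f G)"
  using assms graph_iso_map_graph[of G f] is_graph_map_graph[of G f]
  unfolding family_graph_def by (blast intro: graph_iso_trans)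

text \<open>The vertex set is prescribed exactly, so that these sets are the fibres of the map from
  an \<F>-graph \<open>S\<close> to \<open>(verts S, card (edges S))\<close>.\<close>

definition family_on :: "'a graph set \<Rightarrow> 'b set \<Rightarrow> nat \<Rightarrow> 'b graph set" where
  "family_on \<F> V j = {S. family_graph \<F> S \<and> verts S = V \<and> card (edges S) = j}"

lemma finite_graphs_on:
  assumes "finite V"
  shows "finite {S. is_graph S \<and> verts S \<subseteq> V}"
proof (rule finite_subset)
  show "{S. is_graph S \<and> verts S \<subseteq> V} \<subseteq> Pow V \<times> Pow (Pow V)"
    unfolding is_graph_def by (rule subsetI, clarsimp) blast
qed (use assms in simp)

lemma finite_family_on: "finite V \<Longrightarrow> finite (family_on \<F> V j)"
  by (rule finite_subset[OF _ finite_graphs_on]) (auto simp: family_on_def family_graph_def)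

text \<open>Relabelling along \<open>f\<close> is injective here because edges are subsets of
  \<open>V\<close> and taking images is injective on \<open>Pow V\<close>. An inequality suffices:
  applied also to the inverse bijection, it gives the equality in
  \<open>card_family_on\<close>.\<close>

lemma card_family_on_le:
  assumes "finite W" "bij_betw f V W"
  shows "card (family_on \<F> V j) \<le> card (family_on \<F> W j)"
proof (rule card_inj_on_le)
  have inj: "inj_on f V" and W: "f ` V = W" using assms by (auto simp: bij_betw_def)
  show "map_graph f ` family_on \<F> V j \<subseteq> family_on \<F> W j"
  proof (rule image_subsetI)
    fix S assume S: "S \<in> family_on \<F> V j"
    then have "inj_on ((`) f) (edges S)"
      using inj inj_on_image_edges[of S f] by (auto simp: family_on_def family_graph_def)
    then have "card ((`) f ` edges S) = card (edges S)" by (rule card_image)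
    then show "map_graph f S \<in> family_on \<F> W j"
      using S inj W family_graph_map_graph[of \<F> S f]
      by (auto simp: family_on_def map_graph_def)
  qed
  show "inj_on (map_graph f) (family_on \<F> V j)"
  proof (rule inj_onI)
    fix S T assume ST: "S \<in> family_on \<F> V j" "T \<in> family_on \<F> V j" "map_graph f S = map_graph f T"
    then have "is_graph S" "is_graph T" "verts S = V" "verts T = V"
      by (auto simp: family_on_def family_graph_def)
    then have "edges S \<subseteq> Pow V" "edges T \<subseteq> Pow V" unfolding is_graph_def by blast+
    moreover have "(`) f ` edges S = (`) f ` edges T" using ST by (simp add: map_graph_def)
    ultimately have "edges S = edges T"
      by (rule inj_on_image_eq_iff[OF inj_on_image_Pow[OF inj], THEN iffD1])
    then show "S = T" using ST by (auto simp: family_on_def prod_eq_iff)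
  qed
qed (use assms finite_family_on in auto)

lemma card_family_on:
  assumes "finite V"
  shows "card (family_on \<F> V j) = family_count \<F> (card V) j"
proof -
  obtain f where f: "bij_betw f V {1..card V}"
    using assms ex_bij_betw_nat_finite_1 bij_betw_inv by blast
  have "card (family_on \<F> V j) = card (family_on \<F> {1..card V} j)"
    using card_family_on_le[OF _ f, of \<F> j] card_family_on_le[OF assms bij_betw_inv_into[OF f], of \<F> j]
    by simp
  also have "family_on \<F> {1..card V} j = {G. nm_graph (card V) j G \<and> family_graph \<F> G}"
    by (auto simp: family_on_def nm_graph_def family_graph_def)
  finally show ?thesis by (simp add: family_count_def)
qed

text \<open>Needed for the terms with \<open>j > n choose 2\<close>, where the truncated difference
  \<open>(n choose 2) - j\<close> is not the true exponent of \<open>1 + fps_X\<close>.\<close>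

lemma family_count_eq_0:
  assumes "k choose 2 < j"
  shows "family_count \<F> k j = 0"
proof -
  have False if "nm_graph k j G" for G
    using that assms card_mono[of "two_sets {1..k}" "edges G"]
    by (auto simp: nm_graph_def is_graph_iff card_two_sets)
  then have "{G. nm_graph k j G \<and> family_graph \<F> G} = {}" by blast
  then show ?thesis by (simp only: family_count_def card.empty)
qed

section \<open>Counting the pairs (G, S)\<close>

lemma sum_Pow_card:
  fixes h :: "nat \<Rightarrow> 'b::comm_semiring_1"
  assumes "finite A"
  shows "(\<Sum>V\<in>Pow A. h (card V)) = (\<Sum>k\<le>card A. of_nat (card A choose k) * h k)"
proof -
  have "(\<Sum>V\<in>Pow A. h (card V)) = (\<Sum>k\<le>card A. \<Sum>V\<in>{V \<in> Pow A. card V = k}. h (card V))"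
    by (rule sum.group[symmetric]) (auto simp: assms card_mono)
  also have "\<dots> = (\<Sum>k\<le>card A. of_nat (card A choose k) * h k)"
    by (intro sum.cong refl) (simp add: n_subsets[OF assms, symmetric] Pow_def)
  finally show ?thesis .
qed

lemma distinguished_count_eq:
  "distinguished_count \<F> n m =
    (\<Sum>k\<le>n. (n choose k) *
      (\<Sum>j\<le>m. family_count \<F> k j * (((n choose 2) - j) choose (m - j))))"
proof -
  define V where "V = {1..n}"
  define A where "A = {S. family_graph \<F> S \<and> verts S \<subseteq> V}"
  define c where "c j = (if j \<le> m then ((n choose 2) - j) choose (m - j) else 0)" for j
  define B where "B S = {E. edges S \<subseteq> E \<and> E \<subseteq> two_sets V \<and> card E = m}" for S :: "nat graph"
  have fV: "finite V" and cV: "card V = n" by (auto simp: V_def)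
  have finA: "finite A"
    by (rule finite_subset[OF _ finite_graphs_on[OF fV]]) (auto simp: A_def family_graph_def)
  have verts: "verts S \<subseteq> V" if "S \<in> A" for S using that by (simp add: A_def)
  have edgesA: "edges S \<subseteq> two_sets V" if "S \<in> A" for S
    using that unfolding A_def family_graph_def is_graph_iff by (auto simp: two_sets_def)
  have cardB: "card (B S) = c (card (edges S))" if "S \<in> A" for S
    using card_supersets[OF finite_two_sets[OF fV] edgesA[OF that], of m]
    by (simp add: B_def c_def card_two_sets fV cV)
  have pairs: "((W, E), S) \<in> {(G, S). nm_graph n m G \<and> subgraph S G \<and> family_graph \<F> S}
      \<longleftrightarrow> W = V \<and> S \<in> A \<and> E \<in> B S" for W E S
  proof -
    have "family_graph \<F> S \<Longrightarrow> is_graph S" by (simp add: family_graph_def)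
    then show ?thesis
      by (auto simp: A_def B_def nm_graph_def subgraph_def is_graph_iff V_def)
  qed
  \<comment> \<open>The vertex set of \<open>G\<close> is always \<open>V\<close>, so a pair amounts
    to \<open>S\<close> together with an edge set from \<open>B S\<close>.\<close>
  have "{(G, S). nm_graph n m G \<and> subgraph S G \<and> family_graph \<F> S} =
      (\<lambda>(S, E). ((V, E), S)) ` Sigma A B"
  proof (rule set_eqI)
    fix x :: "nat graph \<times> nat graph"
    obtain W E S where x: "x = ((W, E), S)" by (metis surj_pair)
    show "x \<in> {(G, S). nm_graph n m G \<and> subgraph S G \<and> family_graph \<F> S} \<longleftrightarrow>
        x \<in> (\<lambda>(S, E). ((V, E), S)) ` Sigma A B"
      unfolding x pairs by (auto simp: image_iff)
  qed
  then have "distinguished_count \<F> n m = card (Sigma A B)"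
    unfolding distinguished_count_def by (simp add: card_image inj_on_def split_def prod_eq_iff)
  also have "\<dots> = (\<Sum>S\<in>A. c (card (edges S)))"
    using finA cardB
    by (subst card_SigmaI) (auto simp: B_def fV intro: finite_subset[of _ "Pow (two_sets V)"])
  \<comment> \<open>Subgraphs with more than \<open>m\<close> edges extend to no \<open>G\<close>.
    Dropping them leaves the finite index set \<open>Pow V \<times> {..m}\<close> for grouping by
    vertex set and number of edges.\<close>
  also have "\<dots> = (\<Sum>S\<in>{S\<in>A. card (edges S) \<le> m}. c (card (edges S)))"
    using finA by (intro sum.mono_neutral_right) (auto simp: c_def)
  also have "\<dots> = (\<Sum>(W, j)\<in>Pow V \<times> {..m}.
      \<Sum>S\<in>{S\<in>{S\<in>A. card (edges S) \<le> m}. (verts S, card (edges S)) = (W, j)}. c (card (edges S)))"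
    unfolding case_prod_unfold prod.collapse
    by (rule sum.group[symmetric]) (use finA fV verts in auto)
  also have "\<dots> = (\<Sum>(W, j)\<in>Pow V \<times> {..m}. family_count \<F> (card W) j * c j)"
  proof (rule sum.cong[OF refl], unfold split_paired_all prod.case)
    fix W j assume "(W, j) \<in> Pow V \<times> {..m}"
    then have W: "W \<in> Pow V" "j \<in> {..m}" by auto
    then have "{S\<in>{S\<in>A. card (edges S) \<le> m}. (verts S, card (edges S)) = (W, j)} = family_on \<F> W j"
      by (auto simp: A_def family_on_def)
    moreover have "card (family_on \<F> W j) = family_count \<F> (card W) j"
      using W fV by (intro card_family_on) (auto intro: finite_subset)
    moreover have "card (edges S) = j" if "S \<in> family_on \<F> W j" for S
      using that by (simp add: family_on_def)
    ultimately show "(\<Sum>S\<in>{S\<in>{S\<in>A. card (edges S) \<le> m}. (verts S, card (edges S)) = (W, j)}.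
        c (card (edges S))) = family_count \<F> (card W) j * c j"
      by simp
  qed
  also have "\<dots> = (\<Sum>W\<in>Pow V. \<Sum>j\<le>m. family_count \<F> (card W) j * c j)"
    by (simp add: sum.cartesian_product)
  also have "\<dots> = (\<Sum>k\<le>n. (n choose k) * (\<Sum>j\<le>m. family_count \<F> k j * c j))"
    by (subst sum_Pow_card[OF fV]) (simp add: cV)
  also have "\<dots> = (\<Sum>k\<le>n. (n choose k) *
      (\<Sum>j\<le>m. family_count \<F> k j * (((n choose 2) - j) choose (m - j))))"
    by (simp add: c_def)
  finally show ?thesis .
qed

section \<open>Coefficient extraction\<close>

text \<open>Composition is linear in \<open>a\<close>, so the coefficient can be taken power by
  power; \<open>g ^ j\<close> has order at least \<open>j\<close>, which cuts the sum off at
  \<open>m\<close>.\<close>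

lemma fps_compose_mult_nth:
  fixes a g p :: "'a::comm_ring_1 fps"
  assumes "fps_nth g 0 = 0"
  shows "fps_nth ((a oo g) * p) m = (\<Sum>j\<le>m. fps_nth a j * fps_nth (g ^ j * p) m)"
proof -
  have "fps_nth ((a oo g) * p) m =
      (\<Sum>i=0..m. \<Sum>j=0..i. fps_nth a j * fps_nth (g ^ j) i * fps_nth p (m - i))"
    by (simp add: fps_mult_nth fps_compose_nth sum_distrib_right)
  \<comment> \<open>The added terms have \<open>i < j\<close>, where \<open>g ^ j\<close> has zero
    coefficient. The inner range no longer depends on \<open>i\<close>, so the sums can be
    swapped.\<close>
  also have "\<dots> = (\<Sum>i=0..m. \<Sum>j=0..m. fps_nth a j * fps_nth (g ^ j) i * fps_nth p (m - i))"
    using assms by (intro sum.cong refl sum.mono_neutral_left) (auto simp: startsby_zero_power_prefix)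
  also have "\<dots> = (\<Sum>j=0..m. \<Sum>i=0..m. fps_nth a j * fps_nth (g ^ j) i * fps_nth p (m - i))"
    by (rule sum.swap)
  also have "\<dots> = (\<Sum>j\<le>m. fps_nth a j * fps_nth (g ^ j * p) m)"
    by (simp add: fps_mult_nth sum_distrib_left mult.assoc atLeast0AtMost)
  finally show ?thesis .
qed

lemma fps_nth_one_plus_X_power:
  "fps_nth ((1 + fps_X) ^ N :: 'a::field_char_0 fps) i = of_nat (N choose i)"
  by (metis binomial_gbinomial fps_binomial_nth fps_binomial_of_nat)

text \<open>Each factor \<open>fps_X / (1 + fps_X)\<close> cancels one factor
  \<open>1 + fps_X\<close>, leaving \<open>fps_X ^ j * (1 + fps_X) ^ (N - j)\<close>.\<close>

lemma fps_nth_subst_power: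
  assumes "j \<le> N" "j \<le> m"
  shows "fps_nth ((fps_X / (1 + fps_X)) ^ j * (1 + fps_X) ^ N :: 'a::field_char_0 fps) m
    = of_nat ((N - j) choose (m - j))"
proof -
  have "fps_X / (1 + fps_X) * (1 + fps_X) = (fps_X :: 'a fps)"
    by (simp add: fps_divide_unit mult.assoc inverse_mult_eq_1)
  then have "(fps_X / (1 + fps_X)) ^ j * (1 + fps_X) ^ j = (fps_X ^ j :: 'a fps)"
    by (simp flip: power_mult_distrib)
  moreover have "(1 + fps_X) ^ N = (1 + fps_X) ^ j * (1 + fps_X :: 'a fps) ^ (N - j)"
    using assms by (simp flip: power_add)
  ultimately have "(fps_X / (1 + fps_X)) ^ j * (1 + fps_X) ^ N = (fps_X ^ j * (1 + fps_X) ^ (N - j) :: 'a fps)"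
    by (simp only: mult.assoc[symmetric])
  then show ?thesis using assms by (simp add: fps_X_power_mult_nth fps_nth_one_plus_X_power)
qed

text \<open>The exponential contributes \<open>1 / fact (n - k)\<close> and \<open>gen_fun\<close>
  contributes \<open>1 / fact k\<close>; together with \<open>fact n\<close> they form
  \<open>n choose k\<close>. The remaining factors are those of
  \<open>distinguished_count_eq\<close>.\<close>

lemma coeff2_distinguished:
  "fact n * coeff2 n m (subst_w (gen_fun \<F>) (fps_X / (1 + fps_X)) * in_z (fps_exp 1) *
      in_w ((1 + fps_X) ^ (n choose 2))) = of_nat (distinguished_count \<F> n m)"
proof -
  let ?N = "n choose 2"
  let ?g = "fps_X / (1 + fps_X) :: complex fps"
  let ?p = "(1 + fps_X) ^ ?N :: complex fps"
  let ?F = "\<lambda>k. fps_nth (gen_fun \<F>) k"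
  have g0: "fps_nth ?g 0 = 0" by (simp add: fps_divide_unit)
  have inner: "fps_nth ((?F k oo ?g) * ?p) m =
      (\<Sum>j\<le>m. of_nat (family_count \<F> k j * ((?N - j) choose (m - j)))) / fact k" if "k \<le> n" for k
    unfolding fps_compose_mult_nth[OF g0] sum_divide_distrib
  proof (rule sum.cong[OF refl])
    fix j assume "j \<in> {..m}"
    show "fps_nth (?F k) j * fps_nth (?g ^ j * ?p) m =
        of_nat (family_count \<F> k j * ((?N - j) choose (m - j))) / fact k"
    proof (cases "j \<le> ?N")
      case True
      then show ?thesis using \<open>j \<in> {..m}\<close> fps_nth_subst_power[of j ?N m, where ?'a = complex]
        by (simp add: gen_fun_def)
    next
      \<comment> \<open>No cancellation is available here, but \<open>k \<le> n\<close> forces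
        \<open>k choose 2 < j\<close>, so both sides vanish.\<close>
      case False
      then have "k choose 2 < j" using binomial_right_mono[OF that, of 2] by simp
      then show ?thesis by (simp add: gen_fun_def family_count_eq_0)
    qed
  qed
  have "coeff2 n m (subst_w (gen_fun \<F>) ?g * in_z (fps_exp 1) * in_w ?p) =
      (\<Sum>k=0..n. fps_nth ((?F k oo ?g) * ?p) m / fact (n - k))"
    by (simp add: coeff2_def in_z_def in_w_def subst_w_def fps_mult_nth[of _ _ n]
        sum_distrib_right fps_sum_nth mult.assoc mult.commute[of "fps_const _"])
       (simp add: mult.assoc[symmetric] divide_inverse)
  also have "\<dots> = (\<Sum>k\<le>n. of_nat (n choose k) *
      (\<Sum>j\<le>m. of_nat (family_count \<F> k j * ((?N - j) choose (m - j)))) / fact n)"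
    unfolding atLeast0AtMost
  proof (rule sum.cong[OF refl])
    fix k assume "k \<in> {..n}"
    then show "fps_nth ((?F k oo ?g) * ?p) m / fact (n - k) = of_nat (n choose k) *
        (\<Sum>j\<le>m. of_nat (family_count \<F> k j * ((?N - j) choose (m - j)))) / fact n"
      unfolding atMost_iff by (subst inner) (simp_all add: binomial_fact del: of_nat_mult)
  qed
  also have "\<dots> = of_nat (distinguished_count \<F> n m) / fact n"
    by (simp add: distinguished_count_eq sum_divide_distrib)
  finally show ?thesis by simp
qed

section \<open>Asymptotics\<close>

text \<open>The product \<open>(m choose j) * fact j\<close> is the falling factorial m (m - 1) ...
  (m - j + 1). With the subtraction taken in the reals, the recursion also holds for
  \<open>j > m\<close>, where both sides are 0.\<close>

lemma binomial_fact_Suc: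
  "real (m choose Suc j) * fact (Suc j) = (real m - real j) * (real (m choose j) * fact j)"
proof (cases "j \<le> m")
  case True
  have "Suc j * (m choose Suc j) = (m - j) * (m choose j)"
    using binomial_absorb_comp[of m j] binomial_absorption[of j m] by simp
  then have "real (Suc j) * real (m choose Suc j) = (real m - real j) * real (m choose j)"
    using True by (metis of_nat_mult of_nat_diff)
  then show ?thesis by (simp add: mult_ac)
qed (simp add: binomial_eq_0)

lemma binomial_fact_ge:
  assumes "0 < m"
  shows "real m ^ j * (1 - (real j)\<^sup>2 / real m) \<le> real (m choose j) * fact j"
proof (induction j)
  case (Suc j)
  show ?case
  proof (cases "j \<le> m")
    case True
    define x where "x = real j / real m"
    have x: "0 \<le> x" "x \<le> 1" and m: "real m > 0" using assms True by (auto simp: x_def)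
    \<comment> \<open>The old bound is \<open>1 - real j * x\<close> and the new factor is
      \<open>1 - x\<close>. Their product is at least 1 - (j + j^2) / m, and j + j^2 is at most (j +
      1)^2.\<close>
    have "1 - (real (Suc j))\<^sup>2 / real m \<le> 1 - x - real j * x"
      using m by (simp add: x_def power2_eq_square field_simps)
    also have "\<dots> \<le> (1 - x) * (1 - real j * x)"
      using x by (simp add: algebra_simps)
    finally have "real m ^ Suc j * (1 - (real (Suc j))\<^sup>2 / real m)
        \<le> real m ^ Suc j * ((1 - x) * (1 - real j * x))"
      by (intro mult_left_mono) auto
    also have "\<dots> = (real m - real j) * (real m ^ j * (1 - (real j)\<^sup>2 / real m))"
      using m by (simp add: x_def power2_eq_square field_simps)
    also have "\<dots> \<le> (real m - real j) * (real (m choose j) * fact j)"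
      using Suc.IH True by (intro mult_left_mono) auto
    finally show ?thesis by (simp only: binomial_fact_Suc)
  next
    case False
    \<comment> \<open>Beyond \<open>m\<close> the claimed lower bound is nonpositive, so it holds
      trivially.\<close>
    then have "real m \<le> real (Suc j)" "1 \<le> real (Suc j)" by auto
    then have "real m * 1 \<le> real (Suc j) * real (Suc j)" by (intro mult_mono) auto
    then have "1 - (real (Suc j))\<^sup>2 / real m \<le> 0"
      using assms by (simp add: power2_eq_square field_simps)
    then have "real m ^ Suc j * (1 - (real (Suc j))\<^sup>2 / real m) \<le> 0"
      by (intro mult_nonneg_nonpos) auto
    also have "0 \<le> real (m choose Suc j) * fact (Suc j)" by simp
    finally show ?thesis .
  qed
qed simp

lemma binomial_fact_le: "real (m choose j) * fact j \<le> real m ^ j"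
  using binomial_fact_pow[of m j] by (metis of_nat_fact of_nat_le_iff of_nat_mult of_nat_power)

text \<open>Factor by factor, (m - i) / m is at most (N - i) / N because m is at most N.
  Cross-multiplying avoids divisions.\<close>

lemma binomial_cross_le:
  assumes "m \<le> N"
  shows "real (m choose j) * fact j * real N ^ j \<le> real (N choose j) * fact j * real m ^ j"
proof (induction j)
  case (Suc j)
  show ?case
  proof (cases "j \<le> m")
    case True
    have "real (m choose Suc j) * fact (Suc j) * real N ^ Suc j =
        ((real m - real j) * real N) * (real (m choose j) * fact j * real N ^ j)"
      by (simp only: binomial_fact_Suc) simp
    also have "\<dots> \<le> ((real N - real j) * real m) * (real (N choose j) * fact j * real m ^ j)"
    proof (rule mult_mono)
      have "real m * real j \<le> real N * real j" using assms by (intro mult_right_mono) auto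
      then show "(real m - real j) * real N \<le> (real N - real j) * real m"
        by (simp add: algebra_simps)
    qed (use Suc.IH True assms in auto)
    also have "\<dots> = real (N choose Suc j) * fact (Suc j) * real m ^ Suc j"
      by (simp only: binomial_fact_Suc) simp
    finally show ?thesis .
  qed (simp add: binomial_eq_0)
qed simp

lemma falling_ratio_bounds:
  assumes "0 < n"
  shows "real (n choose k) * fact k / real n ^ k \<in> {max 0 (1 - (real k)\<^sup>2 / real n)..1}"
  using assms binomial_fact_ge[OF assms, of k] binomial_fact_le[of n k]
  by (simp add: field_simps)

text \<open>The upper bound is \<open>binomial_cross_le\<close>. For the lower bound, replacing the
  falling factorial of \<open>N\<close> by \<open>N ^ j\<close> only decreases the ratio and leaves
  that of \<open>m\<close> over \<open>m ^ j\<close>.\<close>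

lemma binomial_ratio_bounds:
  assumes "0 < m" "m \<le> N"
  shows "real (m choose j) / real (N choose j) / (real m / real N) ^ j
    \<in> {max 0 (1 - (real j)\<^sup>2 / real m)..1}"
proof (cases "j \<le> m")
  case True
  let ?c = "real (m choose j) * fact j" and ?d = "real (N choose j) * fact j"
  have d: "0 < ?d" and m: "0 < real m ^ j" using True assms by simp_all
  have eq: "real (m choose j) / real (N choose j) / (real m / real N) ^ j
      = ?c * real N ^ j / (?d * real m ^ j)"
    by (simp add: power_divide)
  have "?c * real N ^ j / (?d * real m ^ j) \<le> 1"
    using binomial_cross_le[OF assms(2), of j] mult_pos_pos[OF d m] by (simp only: divide_le_eq_1) simp
  moreover have "1 - (real j)\<^sup>2 / real m \<le> ?c / real m ^ j"
    using binomial_fact_ge[OF assms(1), of j] m by (simp add: field_simps)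
  moreover have "?c / real m ^ j * 1 \<le> ?c / real m ^ j * (real N ^ j / ?d)"
    using binomial_fact_le[of N j] d by (intro mult_left_mono) (auto simp: le_divide_eq)
  ultimately show ?thesis unfolding eq by (simp add: mult.commute)
next
  case False
  \<comment> \<open>For \<open>j > m\<close> the numerator \<open>m choose j\<close> is 0, so the
    quotient is 0 even if \<open>N choose j\<close> is 0 as well; the lower bound is then 0
    too.\<close>
  then have "real m * 1 \<le> real j * real j" by (intro mult_mono) auto
  then have "1 \<le> (real j)\<^sup>2 / real m" using assms by (simp add: power2_eq_square)
  then show ?thesis using False by (simp add: binomial_eq_0)
qed

text \<open>Trades the quadratic defect for a geometric factor that doubling the arguments of a
  power series absorbs. The factor 2 is there for \<open>k = 3\<close>, where 9 exceeds 8.\<close>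

lemma square_le_two_power: "(real k)\<^sup>2 \<le> 2 * 2 ^ k"
proof (cases "k < 4")
  case True
  then have "k \<in> {0, 1, 2, 3}" by auto
  then show ?thesis by auto
next
  case False
  then have "4 \<le> k" by simp
  then have "k\<^sup>2 \<le> 2 ^ k"
  proof (induction k rule: dec_induct)
    case (step i)
    have "4 * i \<le> i * i" using step by simp
    then have "(Suc i)\<^sup>2 \<le> 2 * i\<^sup>2" using step(1) unfolding power2_eq_square by (simp; presburger)
    then show ?case using step by simp
  qed simp
  then have "real (k\<^sup>2) \<le> real (2 ^ k)" by (simp only: of_nat_le_iff)
  also have "real (2 ^ k) \<le> 2 * 2 ^ k" by simp
  finally show ?thesis by simp
qed

section \<open>Termwise comparison of the count with the generating function\<close>

text \<open>Real terms of F(x, y), so that series can be compared by order; the index is a pair, as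
  in \<open>eval2\<close>.\<close>

definition egf_term :: "'a graph set \<Rightarrow> real \<Rightarrow> real \<Rightarrow> nat \<times> nat \<Rightarrow> real" where
  "egf_term \<F> x y = (\<lambda>(k, j). real (family_count \<F> k j) / fact k * x ^ k * y ^ j)"

lemma egf_term_nonneg: "0 \<le> x \<Longrightarrow> 0 \<le> y \<Longrightarrow> 0 \<le> egf_term \<F> x y p"
  by (simp add: egf_term_def split_def)

lemma eval2_gen_fun:
  assumes "entire2 (gen_fun \<F>)"
  shows "egf_term \<F> x y summable_on UNIV"
    and "eval2 (gen_fun \<F>) (of_real x) (of_real y) = of_real (\<Sum>\<^sub>\<infinity>p. egf_term \<F> x y p)"
proof -
  have eq: "(\<lambda>(i, j). coeff2 i j (gen_fun \<F>) * of_real x ^ i * of_real y ^ j)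
      = (\<lambda>p. complex_of_real (egf_term \<F> x y p))"
    by (auto simp: egf_term_def coeff2_def gen_fun_def)
  have "(\<lambda>p. complex_of_real (egf_term \<F> x y p)) summable_on UNIV"
    using assms unfolding entire2_def eq[symmetric] by blast
  then show *: "egf_term \<F> x y summable_on UNIV"
    using summable_on_Re by fastforce
  show "eval2 (gen_fun \<F>) (of_real x) (of_real y) = of_real (\<Sum>\<^sub>\<infinity>p. egf_term \<F> x y p)"
    unfolding eval2_def eq using has_sum_of_real[OF has_sum_infsum[OF *]] by (rule infsumI)
qed

text \<open>The first factor is the probability that \<open>k\<close> independent uniform draws from
  \<open>n\<close> points are distinct. The second compares the probability that \<open>j\<close>
  given pairs lie in a random \<open>m\<close>-subset of \<open>N\<close> pairs with
  \<open>(m / N) ^ j\<close>.\<close>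

definition weight :: "nat \<Rightarrow> nat \<Rightarrow> nat \<Rightarrow> nat \<times> nat \<Rightarrow> real" where
  "weight n m N = (\<lambda>(k, j). real (n choose k) * fact k / real n ^ k *
     (real (m choose j) / real (N choose j) / (real m / real N) ^ j))"

lemma weight_bounds:
  assumes "0 < n" "0 < m" "m \<le> N"
  shows "0 \<le> weight n m N (k, j)" "weight n m N (k, j) \<le> 1"
    "1 - weight n m N (k, j) \<le> (real k)\<^sup>2 / real n + (real j)\<^sup>2 / real m"
proof -
  define p where "p = real (n choose k) * fact k / real n ^ k"
  define q where "q = real (m choose j) / real (N choose j) / (real m / real N) ^ j"
  have w: "weight n m N (k, j) = p * q" by (simp add: weight_def p_def q_def)
  have p: "0 \<le> p" "p \<le> 1" "1 - p \<le> (real k)\<^sup>2 / real n"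
    using falling_ratio_bounds[OF assms(1), of k] by (auto simp: p_def)
  have q: "0 \<le> q" "q \<le> 1" "1 - q \<le> (real j)\<^sup>2 / real m"
    using binomial_ratio_bounds[OF assms(2,3), of j] by (auto simp: q_def)
  show "0 \<le> weight n m N (k, j)" using p q by (simp add: w)
  show "weight n m N (k, j) \<le> 1" using p q by (simp add: w mult_le_one)
  \<comment> \<open>Expanded, this says that 1 - p q is at most (1 - p) + (1 - q).\<close>
  have "0 \<le> (1 - p) * (1 - q)" using p q by simp
  then show "1 - weight n m N (k, j) \<le> (real k)\<^sup>2 / real n + (real j)\<^sup>2 / real m"
    using p q by (simp add: w algebra_simps)
qed

text \<open>Only finitely many terms survive, as \<open>n choose k\<close> vanishes for
  \<open>k > n\<close> and \<open>m choose j\<close> for \<open>j > m\<close>. The powers in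
  \<open>weight\<close> cancel those in \<open>egf_term\<close>, leaving the summands of
  \<open>distinguished_count_eq\<close> over \<open>N choose m\<close>.\<close>

lemma distinguished_count_has_sum:
  fixes \<F> :: "'a graph set"
  assumes "0 < n" "0 < m" "m \<le> n choose 2"
  defines "N \<equiv> n choose 2"
  shows "((\<lambda>p. egf_term \<F> (real n) (real m / real N) p * weight n m N p) has_sum
    real (distinguished_count \<F> n m) / real (N choose m)) UNIV"
proof (rule has_sum_finite_neutralI[where B = "{..n} \<times> {..m}"])
  have N: "0 < real N" using assms(2,3) unfolding N_def by linarith
  have eq: "egf_term \<F> (real n) (real m / real N) (k, j) * weight n m N (k, j) =
      real (n choose k) * real (family_count \<F> k j) * (real (m choose j) / real (N choose j))" for k j
    using N assms(1,2) by (simp add: egf_term_def weight_def)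
  show "egf_term \<F> (real n) (real m / real N) p * weight n m N p = 0"
    if "p \<in> UNIV - {..n} \<times> {..m}" for p
    using that by (cases p) (auto simp: eq binomial_eq_0)
  have ratio: "real (m choose j) / real (N choose j) = real ((N - j) choose (m - j)) / real (N choose m)"
    if "j \<le> m" for j
  proof -
    \<comment> \<open>Both sides count nested pairs of a \<open>j\<close>-set inside an
      \<open>m\<close>-set, choosing the larger or the smaller set first.\<close>
    have "(N choose m) * (m choose j) = (N choose j) * ((N - j) choose (m - j))"
      using that assms by (intro choose_mult) auto
    then have "real (N choose m) * real (m choose j) = real (N choose j) * real ((N - j) choose (m - j))"
      by (metis of_nat_mult)
    moreover have "real (N choose m) \<noteq> 0" "real (N choose j) \<noteq> 0" using that assms by auto
    ultimately show ?thesis by (simp add: field_simps)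
  qed
  have "real (distinguished_count \<F> n m) / real (N choose m) =
      (\<Sum>k\<le>n. \<Sum>j\<le>m. real (n choose k) * real (family_count \<F> k j) *
        (real ((N - j) choose (m - j)) / real (N choose m)))"
    by (simp add: distinguished_count_eq N_def sum_divide_distrib sum_distrib_left mult.assoc)
  also have "\<dots> = (\<Sum>k\<le>n. \<Sum>j\<le>m. egf_term \<F> (real n) (real m / real N) (k, j) * weight n m N (k, j))"
    by (intro sum.cong refl) (simp only: eq ratio atMost_iff)
  finally show "real (distinguished_count \<F> n m) / real (N choose m) =
      (\<Sum>p\<in>{..n} \<times> {..m}. egf_term \<F> (real n) (real m / real N) p * weight n m N p)"
    by (simp add: sum.cartesian_product split_def)
qed auto

text \<open>Weights at most 1 put the normalised count below F(n, m / N). Conversely, the defect of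
  each term is at most the constant times the same term with both arguments doubled, that is,
  multiplied by \<open>2 ^ k * 2 ^ j\<close>.\<close>

lemma distinguished_count_approx:
  fixes \<F> :: "'a graph set"
  assumes "entire2 (gen_fun \<F>)" "0 < n" "0 < m" "m \<le> n choose 2"
  defines "N \<equiv> n choose 2"
  shows "\<bar>real (distinguished_count \<F> n m) / real (N choose m)
        - (\<Sum>\<^sub>\<infinity>p. egf_term \<F> (real n) (real m / real N) p)\<bar>
    \<le> 2 * (1 / real n + 1 / real m) * (\<Sum>\<^sub>\<infinity>p. egf_term \<F> (2 * real n) (2 * (real m / real N)) p)"
proof -
  let ?a = "egf_term \<F> (real n) (real m / real N)"
  let ?b = "egf_term \<F> (2 * real n) (2 * (real m / real N))"
  let ?t = "\<lambda>p. ?a p * weight n m N p"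
  let ?C = "2 * (1 / real n + 1 / real m)"
  have w: "0 \<le> weight n m N (k, j)" "weight n m N (k, j) \<le> 1"
    "1 - weight n m N (k, j) \<le> (real k)\<^sup>2 / real n + (real j)\<^sup>2 / real m" for k j
    using weight_bounds[of n m N k j] assms by auto
  have a0: "0 \<le> ?a p" for p by (rule egf_term_nonneg) auto
  have t: "(?t has_sum real (distinguished_count \<F> n m) / real (N choose m)) UNIV"
    using distinguished_count_has_sum assms by blast
  have a: "(?a has_sum infsum ?a UNIV) UNIV" and b: "(?b has_sum infsum ?b UNIV) UNIV"
    using eval2_gen_fun(1)[OF assms(1)] by (simp_all add: has_sum_infsum)
  have le: "?t p \<le> ?a p" for p
    using a0[of p] w(2) by (cases p) (simp add: mult_left_le)
  have "?a p - ?t p \<le> ?C * ?b p" for p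
  proof (cases p)
    case (Pair k j)
    have pw: "1 \<le> (2::real) ^ k" "1 \<le> (2::real) ^ j" by simp_all
    have "(real k)\<^sup>2 \<le> 2 * (2 ^ k * 2 ^ j)" "(real j)\<^sup>2 \<le> 2 * (2 ^ k * 2 ^ j)"
      using square_le_two_power[of k] square_le_two_power[of j]
        mult_left_mono[OF pw(2), of "2 ^ k"] mult_right_mono[OF pw(1), of "2 ^ j"]
      by (auto intro: order_trans)
    then have "(real k)\<^sup>2 / real n + (real j)\<^sup>2 / real m
        \<le> 2 * (2 ^ k * 2 ^ j) / real n + 2 * (2 ^ k * 2 ^ j) / real m"
      by (intro add_mono divide_right_mono) auto
    then have "1 - weight n m N p \<le> ?C * (2 ^ k * 2 ^ j)"
      using w(3)[of k j] Pair by (simp add: algebra_simps)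
    then have "?a p * (1 - weight n m N p) \<le> ?a p * (?C * (2 ^ k * 2 ^ j))"
      using a0 by (rule mult_left_mono)
    moreover have "?b p = ?a p * (2 ^ k * 2 ^ j)"
      using Pair by (simp add: egf_term_def power_mult_distrib power_divide)
    ultimately show ?thesis by (simp add: algebra_simps)
  qed
  then have "?a p \<le> ?t p + ?C * ?b p" for p by (simp add: algebra_simps)
  then have "infsum ?a UNIV \<le> real (distinguished_count \<F> n m) / real (N choose m) + ?C * infsum ?b UNIV"
    by (intro has_sum_mono[OF a has_sum_add[OF t has_sum_cmult_right[OF b]]]) auto
  moreover have "real (distinguished_count \<F> n m) / real (N choose m) \<le> infsum ?a UNIV"
    using le by (intro has_sum_mono[OF t a])
  ultimately show ?thesis by simp
qed

lemma distinguished_count_asymp: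
  fixes \<F> :: "'a graph set" and m :: "nat \<Rightarrow> nat"
  defines "F \<equiv> gen_fun \<F>"
  assumes ent: "entire2 F" and m_top: "filterlim m at_top sequentially"
    and m_small: "(\<lambda>n. real (m n)) \<in> o(\<lambda>n. real n ^ 2)"
    and lim: "(\<lambda>n. eval2 F (of_nat n * 2) (of_nat (m n) * 2 / of_nat (n choose 2)) /
        eval2 F (of_nat n) (of_nat (m n) / of_nat (n choose 2))) \<longlonglongrightarrow> l"
  shows "(\<lambda>n. of_nat (distinguished_count \<F> n (m n)) :: complex) \<sim>[sequentially]
    (\<lambda>n. of_nat ((n choose 2) choose m n) *
      eval2 F (of_nat n) (of_nat (m n) / of_nat (n choose 2)))"
\<comment> \<open>Bounding the difference by \<open>c\<close> times the main term needs no division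
  by F, which may vanish.\<close>
proof (rule smallo_imp_asymp_equiv, rule landau_o.smallI)
  fix c :: real assume "0 < c"
  define N where "N n = n choose 2" for n :: nat
  define S where "S n = (\<Sum>\<^sub>\<infinity>p. egf_term \<F> (real n) (real (m n) / real (N n)) p)" for n
  define S2 where "S2 n = (\<Sum>\<^sub>\<infinity>p. egf_term \<F> (2 * real n) (2 * (real (m n) / real (N n))) p)" for n
  have S: "eval2 F (of_nat n) (of_nat (m n) / of_nat (N n)) = of_real (S n)" for n
    using eval2_gen_fun(2)[of \<F> "real n" "real (m n) / real (N n)"] ent by (simp add: S_def F_def)
  have S2: "eval2 F (of_nat n * 2) (of_nat (m n) * 2 / of_nat (N n)) = of_real (S2 n)" for n
    using eval2_gen_fun(2)[of \<F> "2 * real n" "2 * (real (m n) / real (N n))"] ent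
    by (simp add: S2_def F_def mult.commute)
  have S_nonneg: "0 \<le> S n" "0 \<le> S2 n" for n
    by (auto simp: S_def S2_def intro!: infsum_nonneg egf_term_nonneg)
  have m_inf: "filterlim (\<lambda>n. real (m n)) at_top sequentially"
    using filterlim_compose[OF filterlim_real_sequentially m_top] .
  obtain B where B: "\<And>n. norm (eval2 F (of_nat n * 2) (of_nat (m n) * 2 / of_nat (N n)) /
        eval2 F (of_nat n) (of_nat (m n) / of_nat (N n))) \<le> B"
    using convergent_imp_Bseq[OF convergentI[OF lim]] unfolding Bseq_def N_def by blast
  have quot: "S2 n / S n \<le> B" for n
    using B[of n] S_nonneg[of n] by (simp add: S S2 norm_divide)
  have S2_le: "S2 n \<le> B * S n" if "0 < n" "0 < m n" "0 < N n" for n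
  \<comment> \<open>If \<open>S n = 0\<close>, the quotient is 0 by convention and
    \<open>quot\<close> gives nothing. But then every term is 0, and positive arguments force every
    count to be 0, so \<open>S2 n = 0\<close>.\<close>
  proof (cases "S n = 0")
    case True
    have "egf_term \<F> (real n) (real (m n) / real (N n)) p = 0" for p
      using eval2_gen_fun(1) ent True
      by (intro nonneg_infsum_le_0D[where A = UNIV]) (auto simp: S_def F_def egf_term_nonneg)
    then have "family_count \<F> k j = 0" for k j
      using that by (auto simp: egf_term_def split_def dest!: spec[of _ "(k, j)"])
    then show ?thesis by (simp add: True S2_def egf_term_def split_def)
  next
    case False
    then show ?thesis using quot[of n] S_nonneg[of n] by (simp add: divide_le_eq)
  qed
  have "(\<lambda>n. 2 * (1 / real n + 1 / real (m n)) * B) \<longlonglongrightarrow> 2 * (0 + 0) * B"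
    by (intro tendsto_intros lim_1_over_n tendsto_divide_0[OF tendsto_const]
        filterlim_at_top_imp_at_infinity m_inf)
  then have small: "\<forall>\<^sub>F n in sequentially. 2 * (1 / real n + 1 / real (m n)) * B < c"
    using \<open>0 < c\<close> by (auto dest: order_tendstoD)
  \<comment> \<open>The constant 1/4 ensures that \<open>m n\<close> is at most
    \<open>n choose 2\<close>: for n at least 2, n (n - 1) / 2 is at least n^2 / 4.\<close>
  have "\<forall>\<^sub>F n in sequentially. norm (real (m n)) \<le> 1 / 4 * norm (real n ^ 2)"
    using landau_o.smallD[OF m_small, of "1 / 4"] by simp
  moreover have "\<forall>\<^sub>F n in sequentially. 0 < m n"
    using eventually_compose_filterlim[OF eventually_gt_at_top m_top] .
  moreover note small eventually_ge_at_top[of "2::nat"]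
  ultimately show "\<forall>\<^sub>F n in sequentially.
      norm (of_nat (distinguished_count \<F> n (m n)) - of_nat ((n choose 2) choose m n) *
        eval2 F (of_nat n) (of_nat (m n) / of_nat (n choose 2)) :: complex)
      \<le> c * norm (of_nat ((n choose 2) choose m n) *
        eval2 F (of_nat n) (of_nat (m n) / of_nat (n choose 2)))"
  proof eventually_elim
    case (elim n)
    have "real (m n) \<le> real (n choose 2)"
    proof -
      have "4 * real (m n) \<le> real n * real n" using elim by (simp add: power2_eq_square)
      also have "real n * real n \<le> 2 * (real n * (real n - 1))" using elim by (simp add: algebra_simps)
      also have "real n * (real n - 1) = 2 * real (n choose 2)"
        using elim by (simp add: choose_two real_of_nat_div of_nat_diff)
      finally show ?thesis by simp
    qed
    then have mN: "m n \<le> N n" by (simp add: N_def)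
    define D where "D = real (distinguished_count \<F> n (m n))"
    define M where "M = real (N n choose m n)"
    have M: "0 < M" using mN by (simp add: M_def)
    have "\<bar>D / M - S n\<bar> \<le> 2 * (1 / real n + 1 / real (m n)) * S2 n"
      using distinguished_count_approx[of \<F> n "m n"] ent elim mN
      by (simp add: D_def M_def S_def S2_def N_def F_def)
    also have "\<dots> \<le> 2 * (1 / real n + 1 / real (m n)) * (B * S n)"
      using S2_le[of n] elim mN by (intro mult_left_mono) auto
    also have "\<dots> \<le> c * S n"
      using elim S_nonneg[of n] by (simp only: mult.assoc[symmetric]) (intro mult_right_mono; simp)
    finally have "M * \<bar>D / M - S n\<bar> \<le> M * (c * S n)" using M by (intro mult_left_mono) auto
    also have "M * \<bar>D / M - S n\<bar> = \<bar>D - M * S n\<bar>"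
      using M by (simp add: abs_mult_pos' right_diff_distrib)
    finally have *: "\<bar>D - M * S n\<bar> \<le> c * (M * S n)" by (simp add: mult_ac)
    have "of_nat (distinguished_count \<F> n (m n)) - of_nat ((n choose 2) choose m n) *
        eval2 F (of_nat n) (of_nat (m n) / of_nat (n choose 2)) = complex_of_real (D - M * S n)"
      using S[of n] by (simp add: D_def M_def N_def)
    moreover have "of_nat ((n choose 2) choose m n) *
        eval2 F (of_nat n) (of_nat (m n) / of_nat (n choose 2)) = complex_of_real (M * S n)"
      using S[of n] by (simp add: M_def N_def)
    ultimately show ?case using * M S_nonneg[of n] by (simp only: norm_of_real) simp
  qed
qed

theorem theorem1:
  fixes \<F> :: "'a graph set"
  assumes "\<And>H. H \<in> \<F> \<Longrightarrow> is_graph H"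
  defines "F \<equiv> gen_fun \<F>"
  shows "(\<forall>n m. of_nat (distinguished_count \<F> n m) =
           fact n * coeff2 n m (subst_w F (fps_X / (1 + fps_X)) * in_z (fps_exp 1) *
                                in_w ((1 + fps_X) ^ (n choose 2))))
       \<and> (\<forall>m f. entire2 F \<longrightarrow>
            filterlim m at_top sequentially \<longrightarrow>
            (\<lambda>n. real (m n)) \<in> o(\<lambda>n. real n ^ 2) \<longrightarrow>
            analytic2 f \<longrightarrow>
            (\<forall>K. compact K \<longrightarrow>
               uniform_limit K
                 (\<lambda>n (z, w).
                    eval2 F (of_nat n * z) (of_nat (m n) * w / of_nat (n choose 2)) /
                    eval2 F (of_nat n) (of_nat (m n) / of_nat (n choose 2)))
                 f sequentially) \<longrightarrow>
            (\<lambda>n. of_nat (distinguished_count \<F> n (m n)) :: complex) \<sim>[sequentially]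
              (\<lambda>n. of_nat ((n choose 2) choose m n) *
                   eval2 F (of_nat n) (of_nat (m n) / of_nat (n choose 2))))"
proof (rule conjI; intro allI impI)
  show "of_nat (distinguished_count \<F> n m) =
      fact n * coeff2 n m (subst_w F (fps_X / (1 + fps_X)) * in_z (fps_exp 1) *
        in_w ((1 + fps_X) ^ (n choose 2)))" for n m
    unfolding F_def by (rule coeff2_distinguished[symmetric])
next
  fix m :: "nat \<Rightarrow> nat" and f
  assume ent: "entire2 F" and m: "filterlim m at_top sequentially" "(\<lambda>n. real (m n)) \<in> o(\<lambda>n. real n ^ 2)"
    and lim: "\<forall>K. compact K \<longrightarrow>
      uniform_limit K
        (\<lambda>n (z, w).
          eval2 F (of_nat n * z) (of_nat (m n) * w / of_nat (n choose 2)) /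
          eval2 F (of_nat n) (of_nat (m n) / of_nat (n choose 2)))
        f sequentially"
  \<comment> \<open>A single point is compact, and uniform convergence there is just the pointwise
    limit that bounds the effect of doubling.\<close>
  have "uniform_limit {(2, 2)}
      (\<lambda>n (z, w).
        eval2 F (of_nat n * z) (of_nat (m n) * w / of_nat (n choose 2)) /
        eval2 F (of_nat n) (of_nat (m n) / of_nat (n choose 2)))
      f sequentially"
    by (rule lim[rule_format]) simp
  from tendsto_uniform_limitI[OF this, of "(2, 2)"]
  have "(\<lambda>n. eval2 F (of_nat n * 2) (of_nat (m n) * 2 / of_nat (n choose 2)) /
      eval2 F (of_nat n) (of_nat (m n) / of_nat (n choose 2))) \<longlonglongrightarrow> f (2, 2)"
    by (simp only: prod.case insertI1)
  then show "(\<lambda>n. of_nat (distinguished_count \<F> n (m n)) :: complex) \<sim>[sequentially]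
      (\<lambda>n. of_nat ((n choose 2) choose m n) *
        eval2 F (of_nat n) (of_nat (m n) / of_nat (n choose 2)))"
    using ent m unfolding F_def by (intro distinguished_count_asymp)
qed

end
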